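(* Let $\mathfrak{L}$ be a left Leibniz algebra over a field $\mathbb{F}$, let $M$ be an $\mathfrak{L}$-bimodule, and let $f\in\mathrm{Hom}_{\mathbb{F}}(\mathfrak{L}\otimes\mathfrak{L},M)$ be a Leibniz $2$-cocycle. Then the vector space $\mathfrak{E}:=\mathfrak{L}\times M$ with product defined by $$(x_1,m_1)(x_2,m_2):=(x_1x_2,\;m_1\cdot x_2+x_1\cdot m_2+f(x_1\otimes x_2))$$ for any $x_1,x_2\in\mathfrak{L}$ and any $m_1,m_2\in M$ is a left Leibniz algebra.
   Context: A left Leibniz algebra is a vector space $\mathfrak{L}$ with a bilinear multiplication $(x,y)\mapsto xy$ satisfying $x(yz)=(xy)z+y(xz)$ for all $x,y,z\in\mathfrak{L}$. An $\mathfrak{L}$-bimodule is an $\mathbb{F}$-vector space $M$ with a bilinear left action $(x,m)\mapsto x\cdot m$ and a bilinear right action $(m,x)\mapsto m\cdot x$ of $\mathfrak{L}$ such that, for all $x,y\in\mathfrak{L}$, $m\in M$: (LLM) $(xy)\cdot m=x\cdot(y\cdot m)-y\cdot(x\cdot m)$, (LML) $(x\cdot m)\cdot y=x\cdot(m\cdot y)-m\cdot(xy)$, (MLL) $(m\cdot x)\cdot y=m\cdot(xy)-x\cdot(m\cdot y)$. A linear map $f:\mathfrak{L}\otimes\mathfrak{L}\to M$ is a Leibniz $2$-cocycle if $d^2f=0$, where for all $x_1,x_2,x_3\in\mathfrak{L}$ $$(d^2f)(x_1\otimes x_2\otimes x_3)=x_1\cdot f(x_2\otimes x_3)-x_2\cdot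 f(x_1\otimes x_3)-f(x_1\otimes x_2)\cdot x_3-f(x_1x_2\otimes x_3)+f(x_1\otimes x_2x_3)-f(x_2\otimes x_1x_3).$$ *)

theory Defs
  imports "HOL-Analysis.Product_Vector" "HOL-Library.Poly_Mapping"
begin

section \<open>Bilinear maps\<close>

definition bilinear_map ::
  "('f::field \<Rightarrow> 'a::ab_group_add \<Rightarrow> 'a) \<Rightarrow> ('f \<Rightarrow> 'b::ab_group_add \<Rightarrow> 'b) \<Rightarrow>
   ('f \<Rightarrow> 'c::ab_group_add \<Rightarrow> 'c) \<Rightarrow> ('a \<Rightarrow> 'b \<Rightarrow> 'c) \<Rightarrow> bool"
  where "bilinear_map s1 s2 s3 b \<longleftrightarrow>
    (\<forall>x. Vector_Spaces.linear s2 s3 (\<lambda>y. b x y)) \<and>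
    (\<forall>y. Vector_Spaces.linear s1 s3 (\<lambda>x. b x y))"


section \<open>The tensor product of two vector spaces\<close>

text \<open>
  The tensor product is the free vector space on pairs modulo the span of the bilinearity
  relations. Scalar multiplications are explicit parameters here, so the quotient cannot be
  a type of its own: its elements are cosets, and the space is a set of cosets.
\<close>

definition free_scale :: "'f::field \<Rightarrow> ('k \<Rightarrow>\<^sub>0 'f) \<Rightarrow> ('k \<Rightarrow>\<^sub>0 'f)"
  where "free_scale c u = Poly_Mapping.map (\<lambda>a. c * a) u"

abbreviation free_gen :: "'a \<Rightarrow> 'b \<Rightarrow> ('a \<times> 'b \<Rightarrow>\<^sub>0 'f::field)"
  where "free_gen x y \<equiv> Poly_Mapping.single (x, y) 1"

definition tensor_relations ::
  "('f::field \<Rightarrow> 'a::ab_group_add \<Rightarrow> 'a) \<Rightarrow> ('f \<Rightarrow> 'b::ab_group_add \<Rightarrow> 'b) \<Rightarrow>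
   ('a \<times> 'b \<Rightarrow>\<^sub>0 'f) set"
  where "tensor_relations s1 s2 = module.span free_scale
    ({free_gen (x + x') y - free_gen x y - free_gen x' y | x x' y. True} \<union>
     {free_gen x (y + y') - free_gen x y - free_gen x y' | x y y'. True} \<union>
     {free_gen (s1 c x) y - free_scale c (free_gen x y) | c x y. True} \<union>
     {free_gen x (s2 c y) - free_scale c (free_gen x y) | c x y. True})"

definition tensor_class ::
  "('f::field \<Rightarrow> 'a::ab_group_add \<Rightarrow> 'a) \<Rightarrow> ('f \<Rightarrow> 'b::ab_group_add \<Rightarrow> 'b) \<Rightarrow>
   ('a \<times> 'b \<Rightarrow>\<^sub>0 'f) \<Rightarrow> ('a \<times> 'b \<Rightarrow>\<^sub>0 'f) set"
  where "tensor_class s1 s2 u = {u + r | r. r \<in> tensor_relations s1 s2}"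

definition tensor_space ::
  "('f::field \<Rightarrow> 'a::ab_group_add \<Rightarrow> 'a) \<Rightarrow> ('f \<Rightarrow> 'b::ab_group_add \<Rightarrow> 'b) \<Rightarrow>
   ('a \<times> 'b \<Rightarrow>\<^sub>0 'f) set set"
  where "tensor_space s1 s2 = range (tensor_class s1 s2)"

definition tensor ::
  "('f::field \<Rightarrow> 'a::ab_group_add \<Rightarrow> 'a) \<Rightarrow> ('f \<Rightarrow> 'b::ab_group_add \<Rightarrow> 'b) \<Rightarrow>
   'a \<Rightarrow> 'b \<Rightarrow> ('a \<times> 'b \<Rightarrow>\<^sub>0 'f) set"
  where "tensor s1 s2 x y = tensor_class s1 s2 (free_gen x y)"

definition tensor_plus ::
  "('a \<times> 'b \<Rightarrow>\<^sub>0 'f::field) set \<Rightarrow> ('a \<times> 'b \<Rightarrow>\<^sub>0 'f) set \<Rightarrow> ('a \<times> 'b \<Rightarrow>\<^sub>0 'f) set"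
  where "tensor_plus A B = {u + v | u v. u \<in> A \<and> v \<in> B}"

text \<open>Adding the relations back in makes the result a full coset also for the scalar \<open>0\<close>.\<close>

definition tensor_scale ::
  "('f::field \<Rightarrow> 'a::ab_group_add \<Rightarrow> 'a) \<Rightarrow> ('f \<Rightarrow> 'b::ab_group_add \<Rightarrow> 'b) \<Rightarrow>
   'f \<Rightarrow> ('a \<times> 'b \<Rightarrow>\<^sub>0 'f) set \<Rightarrow> ('a \<times> 'b \<Rightarrow>\<^sub>0 'f) set"
  where "tensor_scale s1 s2 c A =
    {free_scale c u + r | u r. u \<in> A \<and> r \<in> tensor_relations s1 s2}"

definition linear_on_tensor ::
  "('f::field \<Rightarrow> 'a::ab_group_add \<Rightarrow> 'a) \<Rightarrow> ('f \<Rightarrow> 'b::ab_group_add \<Rightarrow> 'b) \<Rightarrow>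
   ('f \<Rightarrow> 'c::ab_group_add \<Rightarrow> 'c) \<Rightarrow> (('a \<times> 'b \<Rightarrow>\<^sub>0 'f) set \<Rightarrow> 'c) \<Rightarrow> bool"
  where "linear_on_tensor s1 s2 s3 f \<longleftrightarrow>
    (\<forall>A \<in> tensor_space s1 s2. \<forall>B \<in> tensor_space s1 s2. f (tensor_plus A B) = f A + f B) \<and>
    (\<forall>c. \<forall>A \<in> tensor_space s1 s2. f (tensor_scale s1 s2 c A) = s3 c (f A))"

lemma lookup_free_scale [simp]:
  "Poly_Mapping.lookup (free_scale c u) k = c * Poly_Mapping.lookup u k"
  by (simp add: free_scale_def map.rep_eq when_def)

lemma vector_space_free_scale: "vector_space free_scale"
  by unfold_locales (auto intro!: poly_mapping_eqI simp: lookup_add algebra_simps)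

interpretation free: vector_space free_scale
  by (rule vector_space_free_scale)

lemma subspace_tensor_relations: "free.subspace (tensor_relations s1 s2)"
  by (simp add: tensor_relations_def)

lemma tensor_class_eq_iff:
  "tensor_class s1 s2 u = tensor_class s1 s2 v \<longleftrightarrow> u - v \<in> tensor_relations s1 s2"
proof
  assume "tensor_class s1 s2 u = tensor_class s1 s2 v"
  moreover have "u \<in> tensor_class s1 s2 u"
    using free.subspace_0[OF subspace_tensor_relations[of s1 s2]]
    by (force simp: tensor_class_def)
  ultimately show "u - v \<in> tensor_relations s1 s2"
    by (auto simp: tensor_class_def)
next
  have sub: "tensor_class s1 s2 u \<subseteq> tensor_class s1 s2 v"
    if d: "u - v \<in> tensor_relations s1 s2" for u v
  proof
    fix w assume "w \<in> tensor_class s1 s2 u"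
    then obtain r where r: "r \<in> tensor_relations s1 s2" "w = u + r"
      by (auto simp: tensor_class_def)
    then have "w = v + ((u - v) + r)" "(u - v) + r \<in> tensor_relations s1 s2"
      using free.subspace_add[OF subspace_tensor_relations d] by auto
    then show "w \<in> tensor_class s1 s2 v"
      unfolding tensor_class_def by blast
  qed
  assume d: "u - v \<in> tensor_relations s1 s2"
  then have "v - u \<in> tensor_relations s1 s2"
    using free.subspace_neg[OF subspace_tensor_relations d] by simp
  with d show "tensor_class s1 s2 u = tensor_class s1 s2 v"
    using sub by blast
qed

lemma tensor_plus_class:
  "tensor_plus (tensor_class s1 s2 u) (tensor_class s1 s2 v) = tensor_class s1 s2 (u + v)"
proof (intro subset_antisym subsetI)
  fix w assume "w \<in> tensor_plus (tensor_class s1 s2 u) (tensor_class s1 s2 v)"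
  then obtain r r' where "r \<in> tensor_relations s1 s2" "r' \<in> tensor_relations s1 s2"
      "w = (u + v) + (r + r')"
    by (auto simp: tensor_class_def tensor_plus_def algebra_simps)
  then show "w \<in> tensor_class s1 s2 (u + v)"
    using free.subspace_add[OF subspace_tensor_relations] unfolding tensor_class_def by blast
next
  fix w assume "w \<in> tensor_class s1 s2 (u + v)"
  then obtain r where "r \<in> tensor_relations s1 s2" "w = (u + r) + (v + 0)"
    by (auto simp: tensor_class_def algebra_simps)
  then show "w \<in> tensor_plus (tensor_class s1 s2 u) (tensor_class s1 s2 v)"
    using free.subspace_0[OF subspace_tensor_relations]
    unfolding tensor_class_def tensor_plus_def by blast
qed

lemma tensor_scale_class:
  "tensor_scale s1 s2 c (tensor_class s1 s2 u) = tensor_class s1 s2 (free_scale c u)"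
proof (intro subset_antisym subsetI)
  fix w assume "w \<in> tensor_scale s1 s2 c (tensor_class s1 s2 u)"
  then obtain r r' where r: "r \<in> tensor_relations s1 s2" "r' \<in> tensor_relations s1 s2"
      "w = free_scale c u + (free_scale c r + r')"
    by (auto simp: tensor_class_def tensor_scale_def free.scale_right_distrib algebra_simps)
  have "free_scale c r + r' \<in> tensor_relations s1 s2"
    using r free.subspace_add[OF subspace_tensor_relations]
      free.subspace_scale[OF subspace_tensor_relations] by blast
  with r(3) show "w \<in> tensor_class s1 s2 (free_scale c u)"
    unfolding tensor_class_def by blast
next
  fix w assume "w \<in> tensor_class s1 s2 (free_scale c u)"
  then obtain r where "r \<in> tensor_relations s1 s2" "w = free_scale c (u + 0) + r"
    by (auto simp: tensor_class_def)
  then show "w \<in> tensor_scale s1 s2 c (tensor_class s1 s2 u)"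
    using free.subspace_0[OF subspace_tensor_relations]
    unfolding tensor_class_def tensor_scale_def by blast
qed

lemma tensor_in_space: "tensor s1 s2 x y \<in> tensor_space s1 s2"
  by (simp add: tensor_def tensor_space_def)

lemma tensor_bilinear:
  "tensor s1 s2 (x + x') y = tensor_plus (tensor s1 s2 x y) (tensor s1 s2 x' y)"
  "tensor s1 s2 x (y + y') = tensor_plus (tensor s1 s2 x y) (tensor s1 s2 x y')"
  "tensor s1 s2 (s1 c x) y = tensor_scale s1 s2 c (tensor s1 s2 x y)"
  "tensor s1 s2 x (s2 c y) = tensor_scale s1 s2 c (tensor s1 s2 x y)"
  unfolding tensor_def tensor_plus_class tensor_scale_class tensor_class_eq_iff
    tensor_relations_def diff_diff_eq[symmetric]
  by (rule free.span_base; blast)+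

text \<open>Universal property: linear maps on the tensor product are the same as bilinear maps.\<close>

lemma linear_on_tensor_imp_bilinear_map:
  assumes "vector_space s1" "vector_space s2" "vector_space s3"
    and "linear_on_tensor s1 s2 s3 f"
  shows "bilinear_map s1 s2 s3 (\<lambda>x y. f (tensor s1 s2 x y))"
  using assms
  by (simp add: bilinear_map_def linear_on_tensor_def Vector_Spaces.linear_iff
      tensor_bilinear tensor_in_space)

lemma bilinear_map_imp_linear_on_tensor:
  assumes b: "bilinear_map s1 s2 s3 b"
  shows "\<exists>f. linear_on_tensor s1 s2 s3 f \<and> (\<forall>x y. f (tensor s1 s2 x y) = b x y)"
proof -
  interpret l1: Vector_Spaces.linear s2 s3 "b x" for x
    using b by (simp add: bilinear_map_def)
  interpret l2: Vector_Spaces.linear s1 s3 "\<lambda>x. b x y" for y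
    using b by (simp add: bilinear_map_def)
  define g where "g u = (\<Sum>k\<in>Poly_Mapping.keys u. s3 (Poly_Mapping.lookup u k) (b (fst k) (snd k)))"
    for u :: "'b \<times> 'c \<Rightarrow>\<^sub>0 'a"
  have g_eq: "g u = (\<Sum>k\<in>K. s3 (Poly_Mapping.lookup u k) (b (fst k) (snd k)))"
    if "finite K" "Poly_Mapping.keys u \<subseteq> K" for u K
    unfolding g_def using that
    by (intro sum.mono_neutral_left) (auto simp: in_keys_iff)
  have g_add: "g (u + v) = g u + g v" for u v
  proof -
    let ?K = "Poly_Mapping.keys u \<union> Poly_Mapping.keys v"
    have "Poly_Mapping.keys (u + v) \<subseteq> ?K" by (rule Poly_Mapping.keys_add)
    then show ?thesis
      by (simp add: g_eq[of ?K] lookup_add l1.vs2.scale_left_distrib sum.distrib)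
  qed
  have g_scale: "g (free_scale c u) = s3 c (g u)" for c u
  proof -
    have "Poly_Mapping.keys (free_scale c u) \<subseteq> Poly_Mapping.keys u"
      by (auto simp: in_keys_iff)
    then show ?thesis
      by (simp add: g_eq[of "Poly_Mapping.keys u"] l1.vs2.scale_sum_right)
  qed
  have g_gen: "g (free_gen x y) = b x y" for x y
    by (simp add: g_def)
  interpret g: Vector_Spaces.linear free_scale s3 g
    by unfold_locales (simp_all add: g_add g_scale)
  have ker: "g r = 0" if "r \<in> tensor_relations s1 s2" for r
    by (rule g.eq_0_on_span[OF _ that[unfolded tensor_relations_def]])
      (auto simp: g.diff g_scale g_gen l1.add l2.add l1.scale l2.scale)
  define f where "f A = g (SOME u. u \<in> A)" for A
  have f_class: "f (tensor_class s1 s2 u) = g u" for u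
  proof -
    have "u \<in> tensor_class s1 s2 u"
      using free.subspace_0[OF subspace_tensor_relations[of s1 s2]]
      by (force simp: tensor_class_def)
    then have "(SOME v. v \<in> tensor_class s1 s2 u) \<in> tensor_class s1 s2 u"
      by (rule someI)
    then show ?thesis
      by (auto simp: f_def tensor_class_def g.add ker)
  qed
  have "linear_on_tensor s1 s2 s3 f"
    by (auto simp: linear_on_tensor_def tensor_space_def tensor_plus_class tensor_scale_class
        f_class g.add g_scale)
  moreover have "f (tensor s1 s2 x y) = b x y" for x y
    by (simp add: tensor_def f_class g_gen)
  ultimately show ?thesis by blast
qed


section \<open>Left Leibniz algebras, bimodules and 2-cocycles\<close>

locale left_leibniz_algebra = vector_space scale
  for scale :: "'f::field \<Rightarrow> 'l::ab_group_add \<Rightarrow> 'l" +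
  fixes mul :: "'l \<Rightarrow> 'l \<Rightarrow> 'l"
  assumes bilinear_mul: "bilinear_map scale scale scale mul"
    and left_leibniz: "mul x (mul y z) = mul (mul x y) z + mul y (mul x z)"

locale leibniz_bimodule =
  left_leibniz_algebra scaleL mul + M: vector_space scaleM
  for scaleL :: "'f::field \<Rightarrow> 'l::ab_group_add \<Rightarrow> 'l"
    and mul :: "'l \<Rightarrow> 'l \<Rightarrow> 'l"
    and scaleM :: "'f \<Rightarrow> 'm::ab_group_add \<Rightarrow> 'm" +
  fixes lact :: "'l \<Rightarrow> 'm \<Rightarrow> 'm"
    and ract :: "'m \<Rightarrow> 'l \<Rightarrow> 'm"
  assumes bilinear_lact: "bilinear_map scaleL scaleM scaleM lact"
    and bilinear_ract: "bilinear_map scaleM scaleL scaleM ract"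
    and LLM: "lact (mul x y) m = lact x (lact y m) - lact y (lact x m)"
    and LML: "ract (lact x m) y = lact x (ract m y) - ract m (mul x y)"
    and MLL: "ract (ract m x) y = ract m (mul x y) - lact x (ract m y)"

text \<open>
  The map \<open>d2 f\<close> on the triple tensor product, given by its values on pure tensors
  \<open>x1 \<otimes> x2 \<otimes> x3\<close>; since these span, \<open>d2 f = 0\<close> means that all these values vanish.
\<close>

definition leibniz_d2 ::
  "('f::field \<Rightarrow> 'l::ab_group_add \<Rightarrow> 'l) \<Rightarrow> ('l \<Rightarrow> 'l \<Rightarrow> 'l) \<Rightarrow>
   ('l \<Rightarrow> 'm::ab_group_add \<Rightarrow> 'm) \<Rightarrow> ('m \<Rightarrow> 'l \<Rightarrow> 'm) \<Rightarrow>
   (('l \<times> 'l \<Rightarrow>\<^sub>0 'f) set \<Rightarrow> 'm) \<Rightarrow> 'l \<Rightarrow> 'l \<Rightarrow> 'l \<Rightarrow> 'm"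
  where "leibniz_d2 scaleL mul lact ract f x1 x2 x3 =
    (let t = tensor scaleL scaleL in
      lact x1 (f (t x2 x3)) - lact x2 (f (t x1 x3)) - ract (f (t x1 x2)) x3
      - f (t (mul x1 x2) x3) + f (t x1 (mul x2 x3)) - f (t x2 (mul x1 x3)))"

definition leibniz_2_cocycle ::
  "('f::field \<Rightarrow> 'l::ab_group_add \<Rightarrow> 'l) \<Rightarrow> ('l \<Rightarrow> 'l \<Rightarrow> 'l) \<Rightarrow>
   ('f \<Rightarrow> 'm::ab_group_add \<Rightarrow> 'm) \<Rightarrow> ('l \<Rightarrow> 'm \<Rightarrow> 'm) \<Rightarrow> ('m \<Rightarrow> 'l \<Rightarrow> 'm) \<Rightarrow>
   (('l \<times> 'l \<Rightarrow>\<^sub>0 'f) set \<Rightarrow> 'm) \<Rightarrow> bool"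
  where "leibniz_2_cocycle scaleL mul scaleM lact ract f \<longleftrightarrow>
    linear_on_tensor scaleL scaleL scaleM f \<and>
    (\<forall>x1 x2 x3. leibniz_d2 scaleL mul lact ract f x1 x2 x3 = 0)"

end

theory Submission
  imports Defs
begin

text \<open>Compare both sides of the Leibniz identity for (x, m), (y, n), (z, p). The first
  components agree because \<open>mul\<close> is a left Leibniz product. The second components split
  by bilinearity into four groups: the terms in m match by \<open>MLL\<close>, those in n by
  \<open>LML\<close>, those in p by \<open>LLM\<close>, and those in \<open>f\<close> by the cocycle
  identity. The product itself is bilinear because \<open>mul\<close>, the two actions and
  \<open>f\<close> on pure tensors are.\<close>

lemma bilinear_map_iff:
  assumes "vector_space s1" "vector_space s2" "vector_space s3"
  shows "bilinear_map s1 s2 s3 b \<longleftrightarrow>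
    (\<forall>x y y'. b x (y + y') = b x y + b x y') \<and> (\<forall>x c y. b x (s2 c y) = s3 c (b x y)) \<and>
    (\<forall>x x' y. b (x + x') y = b x y + b x' y) \<and> (\<forall>c x y. b (s1 c x) y = s3 c (b x y))"
  using assms by (auto simp: bilinear_map_def Vector_Spaces.linear_iff)

theorem lemma4p7:
  fixes scaleL :: "'f::field \<Rightarrow> 'l::ab_group_add \<Rightarrow> 'l"
    and mul :: "'l \<Rightarrow> 'l \<Rightarrow> 'l"
    and scaleM :: "'f \<Rightarrow> 'm::ab_group_add \<Rightarrow> 'm"
    and lact :: "'l \<Rightarrow> 'm \<Rightarrow> 'm"
    and ract :: "'m \<Rightarrow> 'l \<Rightarrow> 'm"
    and f :: "('l \<times> 'l \<Rightarrow>\<^sub>0 'f) set \<Rightarrow> 'm"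
  assumes "left_leibniz_algebra scaleL mul"
    and "leibniz_bimodule scaleL mul scaleM lact ract"
    and "leibniz_2_cocycle scaleL mul scaleM lact ract f"
  shows "left_leibniz_algebra (module_prod.scale scaleL scaleM)
    (\<lambda>(x1, m1) (x2, m2).
      (mul x1 x2, ract m1 x2 + lact x1 m2 + f (tensor scaleL scaleL x1 x2)))"
proof -
  interpret leibniz_bimodule scaleL mul scaleM lact ract by fact
  interpret P: vector_space_prod scaleL scaleM ..
  let ?g = "\<lambda>x y. f (tensor scaleL scaleL x y)"
  have vL: "vector_space scaleL" and vM: "vector_space scaleM" and vP: "vector_space P.scale"
    by unfold_locales
  \<comment> \<open>By the universal property, \<open>f\<close> enters from here on as an ordinary
    bilinear map on pairs.\<close>
  have bilin_g: "bilinear_map scaleL scaleL scaleM ?g"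
    using assms(3) vL vM
    by (intro linear_on_tensor_imp_bilinear_map) (auto simp: leibniz_2_cocycle_def)
  have cocycle: "lact x (?g y z) - lact y (?g x z) - ract (?g x y) z
      - ?g (mul x y) z + ?g x (mul y z) - ?g y (mul x z) = 0" for x y z
    using assms(3) by (simp add: leibniz_2_cocycle_def leibniz_d2_def Let_def)
  note bilin_mul = bilinear_mul[unfolded bilinear_map_iff[OF vL vL vL]]
    and bilin_lact = bilinear_lact[unfolded bilinear_map_iff[OF vL vM vM]]
    and bilin_ract = bilinear_ract[unfolded bilinear_map_iff[OF vM vL vM]]
    and bilin_f = bilin_g[unfolded bilinear_map_iff[OF vL vL vM]]
  show ?thesis
  \<comment> \<open>The interpretation \<open>P\<close> already supplies the vector space axioms;
    bilinearity and the Leibniz identity remain.\<close>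
  proof (unfold_locales, goal_cases)
    case 1
    show ?case
      by (auto simp: bilinear_map_iff[OF vP vP vP] P.scale_def bilin_mul bilin_lact bilin_ract
          bilin_f algebra_simps)
  next
    case (2 u v w)
    obtain x m y n z p where uvw: "u = (x, m)" "v = (y, n)" "w = (z, p)"
      by (cases u, cases v, cases w) auto
    \<comment> \<open>The cocycle identity without subtraction: on the left the
      \<open>f\<close>-terms of u(vw), on the right those of (uv)w + v(uw).\<close>
    have "lact x (?g y z) + ?g x (mul y z)
        = lact y (?g x z) + ract (?g x y) z + ?g (mul x y) z + ?g y (mul x z)"
      using cocycle[of x y z] by (simp add: algebra_simps)
    then show ?case
      \<comment> \<open>\<open>left_leibniz\<close> is instantiated because its right-hand side
        contains another instance of its left-hand side, so the general rule would loop.\<close>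
      by (simp add: uvw left_leibniz[of x y z] bilin_lact bilin_ract LLM LML MLL algebra_simps)
  qed
qed

end
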